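(* Let $\alpha\in\mathbb{R}$, let $\mathbf{e}_1,\mathbf{e}_2,\mathbf{e}_3$ be a left invariant frame on $\mathrm{SU}(2)$ with $[\mathbf{e}_2,\mathbf{e}_3]=\mathbf{e}_1$, $[\mathbf{e}_3,\mathbf{e}_1]=\mathbf{e}_2$, $[\mathbf{e}_1,\mathbf{e}_2]=\mathbf{e}_3$, with dual coframe $\omega^1,\omega^2,\omega^3$, and let $A,B,C>0$. The left invariant metric $\mathbf{g}=A\,\omega^{1}\otimes\omega^{1}+B\,\omega^{2}\otimes\omega^{2}+C\,\omega^{3}\otimes\omega^{3}$ is an algebraic soliton that gives rise to a self-similar solution of the $\mathrm{RG}$-$2$ flow with coupling constant $\alpha$ on $\mathrm{SU}(2)$ (i.e. a steady algebraic $\mathrm{RG}$-$2$ soliton) if and only if one of the following holds: 1. $\mathbf{g}$ has constant sectional curvature ($A=B=C$) and $\alpha=-8A$; 2. $A=\frac43B=\frac43C$ and $\alpha=-\frac92A$; 3. $A=B=\frac34C$ and $\alpha=-6A$; 4. $A=C=\frac34B$ and $\alpha=-6A$.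
   Context: Let $\mathfrak{h}$ denote the Lie algebra of $\mathrm{SU}(2)$. The $\mathrm{RG}$-$2$ flow with coupling constant $\alpha$ is $\frac{\partial\mathbf{g}}{\partial t}=\mathbf{RG}[\mathbf{g}]:=-2\mathbf{Rc}[\mathbf{g}]-\frac{\alpha}{2}\mathbf{Rm}^{2}[\mathbf{g}]$, where $\mathbf{Rc}[\mathbf{g}]$ is the Ricci tensor and $\mathbf{Rm}^{2}[\mathbf{g}]$ has components $\check{R}_{ij}=Rm_{iklm}Rm_{jpqr}g^{kp}g^{lq}g^{mr}$, with $Rm_{ijkl}$ the Riemannian curvature tensor of $\mathbf{g}$. The operator $\widehat{\mathbf{RG}[\mathbf{g}]}:\mathfrak{h}\to\mathfrak{h}$ is defined by $\mathbf{g}(\widehat{\mathbf{RG}[\mathbf{g}]}(X),Y)=\mathbf{RG}[\mathbf{g}](X,Y)$. A left invariant metric $\mathbf{g}$ is an algebraic $\mathrm{RG}$-$2$ soliton with soliton constant $\kappa\in\mathbb{R}$ if $\widehat{\mathbf{RG}[\mathbf{g}]}-\kappa\,\mathrm{Id}$ is a derivation of $\mathfrak{h}$; it is steady if $\kappa=0$. By convention, the $\mathrm{RG}$-$2$ algebraic solitons "giving rise to a self-similar solution" are exactly the steady ones (evolving by diffeomorphisms only). *)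

theory Defs
  imports "HOL-Analysis.Analysis"
begin

text \<open>
  A manifold is represented by a set M in a Euclidean space, thought of as a closed embedded
  submanifold; the definitions of the first part are the usual notions for such an M. Vector
  fields on M are functions on the ambient space that vanish outside M, so that two fields are
  equal as functions iff they agree on M.
\<close>

text \<open>Continuous differentiability of order k on an open set, by iterated directional derivatives.\<close>

primrec Ck_on :: "nat \<Rightarrow> 'a::euclidean_space set \<Rightarrow> ('a \<Rightarrow> 'b::real_normed_vector) \<Rightarrow> bool" where
  "Ck_on 0 U f \<longleftrightarrow> continuous_on U f"
| "Ck_on (Suc k) U f \<longleftrightarrow>
     f differentiable_on U \<and> (\<forall>v. Ck_on k U (\<lambda>x. frechet_derivative f (at x) v))"

definition smooth_on :: "'a::euclidean_space set \<Rightarrow> ('a \<Rightarrow> 'b::real_normed_vector) \<Rightarrow> bool" where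
  "smooth_on M f \<longleftrightarrow>
     (\<exists>U F. open U \<and> M \<subseteq> U \<and> (\<forall>k. Ck_on k U F) \<and> (\<forall>p\<in>M. F p = f p))"

definition curve_through ::
  "'a::euclidean_space set \<Rightarrow> 'a \<Rightarrow> 'a \<Rightarrow> (real \<Rightarrow> 'a) \<Rightarrow> bool" where
  "curve_through M p v c \<longleftrightarrow>
     (\<forall>t. c t \<in> M) \<and> c 0 = p \<and> (c has_vector_derivative v) (at 0)"

definition tangent_space :: "'a::euclidean_space set \<Rightarrow> 'a \<Rightarrow> 'a set" where
  "tangent_space M p = {v. \<exists>c. curve_through M p v c}"

text \<open>The derivative at p, in the direction of a tangent vector v, of a function defined on M.\<close>

definition deriv_along ::
  "'a::euclidean_space set \<Rightarrow> ('a \<Rightarrow> 'b::real_normed_vector) \<Rightarrow> 'a \<Rightarrow> 'a \<Rightarrow> 'b" where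
  "deriv_along M f p v =
     (THE d. \<forall>c. curve_through M p v c \<longrightarrow> ((\<lambda>t. f (c t)) has_vector_derivative d) (at 0))"

definition vector_fields :: "'a::euclidean_space set \<Rightarrow> ('a \<Rightarrow> 'a) set" where
  "vector_fields M =
     {X. smooth_on M X \<and> (\<forall>p\<in>M. X p \<in> tangent_space M p) \<and> (\<forall>p. p \<notin> M \<longrightarrow> X p = 0)}"

text \<open>
  The commutator XY - YX of derivations; for fields tangent to a submanifold of a Euclidean space
  it is computed from the componentwise derivatives.
\<close>

definition lie_bracket ::
  "'a::euclidean_space set \<Rightarrow> ('a \<Rightarrow> 'a) \<Rightarrow> ('a \<Rightarrow> 'a) \<Rightarrow> 'a \<Rightarrow> 'a" where
  "lie_bracket M X Y =
     (\<lambda>p. if p \<in> M then deriv_along M Y p (X p) - deriv_along M X p (Y p) else 0)"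

definition is_frame :: "'a::euclidean_space set \<Rightarrow> ('i::finite \<Rightarrow> 'a \<Rightarrow> 'a) \<Rightarrow> bool" where
  "is_frame M e \<longleftrightarrow>
     (\<forall>i. e i \<in> vector_fields M) \<and>
     (\<forall>p\<in>M. inj (\<lambda>i. e i p) \<and> independent (range (\<lambda>i. e i p)) \<and>
        span (range (\<lambda>i. e i p)) = tangent_space M p)"

definition is_dual_coframe ::
  "'a::euclidean_space set \<Rightarrow> ('i::finite \<Rightarrow> 'a \<Rightarrow> 'a) \<Rightarrow> ('i \<Rightarrow> 'a \<Rightarrow> 'a \<Rightarrow> real) \<Rightarrow> bool" where
  "is_dual_coframe M e \<omega> \<longleftrightarrow>
     (\<forall>i. \<forall>p\<in>M.
        (\<forall>u\<in>tangent_space M p. \<forall>v\<in>tangent_space M p. \<forall>a b.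
           \<omega> i p (a *\<^sub>R u + b *\<^sub>R v) = a * \<omega> i p u + b * \<omega> i p v) \<and>
        (\<forall>j. \<omega> i p (e j p) = (if i = j then 1 else 0)))"

text \<open>
  A metric is a function g such that g p is the inner product on the tangent space at p;
  nabla X Y is the covariant derivative of Y in the direction of X.
\<close>

definition levi_civita_connection ::
  "'a::euclidean_space set \<Rightarrow> ('a \<Rightarrow> 'a \<Rightarrow> 'a \<Rightarrow> real) \<Rightarrow>
   (('a \<Rightarrow> 'a) \<Rightarrow> ('a \<Rightarrow> 'a) \<Rightarrow> 'a \<Rightarrow> 'a) \<Rightarrow> bool" where
  "levi_civita_connection M g nabla \<longleftrightarrow>
     (\<forall>X\<in>vector_fields M. \<forall>Y\<in>vector_fields M.
        nabla X Y \<in> vector_fields M \<and>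
        (\<forall>Z\<in>vector_fields M. \<forall>p\<in>M.
           nabla (\<lambda>q. X q + Z q) Y p = nabla X Y p + nabla Z Y p \<and>
           nabla X (\<lambda>q. Y q + Z q) p = nabla X Y p + nabla X Z p) \<and>
        (\<forall>f :: 'a \<Rightarrow> real. smooth_on M f \<longrightarrow> (\<forall>p\<in>M.
           nabla (\<lambda>q. f q *\<^sub>R X q) Y p = f p *\<^sub>R nabla X Y p \<and>
           nabla X (\<lambda>q. f q *\<^sub>R Y q) p =
             deriv_along M f p (X p) *\<^sub>R Y p + f p *\<^sub>R nabla X Y p)) \<and>
        (\<forall>p\<in>M. nabla X Y p - nabla Y X p = lie_bracket M X Y p) \<and>
        (\<forall>Z\<in>vector_fields M. \<forall>p\<in>M.
           deriv_along M (\<lambda>q. g q (Y q) (Z q)) p (X p) =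
             g p (nabla X Y p) (Z p) + g p (Y p) (nabla X Z p)))"

definition Rm ::
  "'a::euclidean_space set \<Rightarrow> ('a \<Rightarrow> 'a \<Rightarrow> 'a \<Rightarrow> real) \<Rightarrow>
   (('a \<Rightarrow> 'a) \<Rightarrow> ('a \<Rightarrow> 'a) \<Rightarrow> 'a \<Rightarrow> 'a) \<Rightarrow>
   ('a \<Rightarrow> 'a) \<Rightarrow> ('a \<Rightarrow> 'a) \<Rightarrow> ('a \<Rightarrow> 'a) \<Rightarrow> ('a \<Rightarrow> 'a) \<Rightarrow> 'a \<Rightarrow> real" where
  "Rm M g nabla X Y Z W p =
     g p (nabla X (nabla Y Z) p - nabla Y (nabla X Z) p - nabla (lie_bracket M X Y) Z p) (W p)"

text \<open>The components of the inverse metric in the frame e.\<close>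

definition inv_metric ::
  "('a \<Rightarrow> 'a \<Rightarrow> 'a \<Rightarrow> real) \<Rightarrow> ('i::finite \<Rightarrow> 'a \<Rightarrow> 'a) \<Rightarrow> 'i \<Rightarrow> 'i \<Rightarrow> 'a \<Rightarrow> real" where
  "inv_metric g e k l p =
     matrix_inv ((\<chi> i j. g p (e i p) (e j p)) :: real ^ 'i ^ 'i) $ k $ l"

text \<open>
  The contractions below are written in the components of a frame e but do not depend on it.
  With this convention the Ricci tensor of a round sphere is positive definite.
\<close>

definition Rc ::
  "'a::euclidean_space set \<Rightarrow> ('a \<Rightarrow> 'a \<Rightarrow> 'a \<Rightarrow> real) \<Rightarrow>
   (('a \<Rightarrow> 'a) \<Rightarrow> ('a \<Rightarrow> 'a) \<Rightarrow> 'a \<Rightarrow> 'a) \<Rightarrow> ('i::finite \<Rightarrow> 'a \<Rightarrow> 'a) \<Rightarrow>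
   ('a \<Rightarrow> 'a) \<Rightarrow> ('a \<Rightarrow> 'a) \<Rightarrow> 'a \<Rightarrow> real" where
  "Rc M g nabla e X Y p =
     (\<Sum>k\<in>UNIV. \<Sum>l\<in>UNIV. inv_metric g e k l p * Rm M g nabla (e k) X Y (e l) p)"

definition Rm2 ::
  "'a::euclidean_space set \<Rightarrow> ('a \<Rightarrow> 'a \<Rightarrow> 'a \<Rightarrow> real) \<Rightarrow>
   (('a \<Rightarrow> 'a) \<Rightarrow> ('a \<Rightarrow> 'a) \<Rightarrow> 'a \<Rightarrow> 'a) \<Rightarrow> ('i::finite \<Rightarrow> 'a \<Rightarrow> 'a) \<Rightarrow>
   ('a \<Rightarrow> 'a) \<Rightarrow> ('a \<Rightarrow> 'a) \<Rightarrow> 'a \<Rightarrow> real" where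
  "Rm2 M g nabla e X Y x =
     (\<Sum>k\<in>UNIV. \<Sum>l\<in>UNIV. \<Sum>m\<in>UNIV. \<Sum>p\<in>UNIV. \<Sum>q\<in>UNIV. \<Sum>r\<in>UNIV.
        Rm M g nabla X (e k) (e l) (e m) x * Rm M g nabla Y (e p) (e q) (e r) x *
        inv_metric g e k p x * inv_metric g e l q x * inv_metric g e m r x)"

definition RG ::
  "'a::euclidean_space set \<Rightarrow> ('a \<Rightarrow> 'a \<Rightarrow> 'a \<Rightarrow> real) \<Rightarrow>
   (('a \<Rightarrow> 'a) \<Rightarrow> ('a \<Rightarrow> 'a) \<Rightarrow> 'a \<Rightarrow> 'a) \<Rightarrow> ('i::finite \<Rightarrow> 'a \<Rightarrow> 'a) \<Rightarrow> real \<Rightarrow>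
   ('a \<Rightarrow> 'a) \<Rightarrow> ('a \<Rightarrow> 'a) \<Rightarrow> 'a \<Rightarrow> real" where
  "RG M g nabla e \<alpha> X Y p =
     - 2 * Rc M g nabla e X Y p - \<alpha> / 2 * Rm2 M g nabla e X Y p"

text \<open>
  From here on G is a Lie group of complex n by n matrices. Left translation by a is the
  restriction of a linear map, so its differential is again multiplication by a.
\<close>

definition lie_algebra ::
  "(complex^'n^'n) set \<Rightarrow> (complex^'n^'n \<Rightarrow> complex^'n^'n) set" where
  "lie_algebra G = {X \<in> vector_fields G. \<forall>a\<in>G. \<forall>p\<in>G. X (a ** p) = a ** X p}"

definition is_derivation ::
  "(complex^'n^'n) set \<Rightarrow>
   ((complex^'n^'n \<Rightarrow> complex^'n^'n) \<Rightarrow> (complex^'n^'n \<Rightarrow> complex^'n^'n)) \<Rightarrow> bool" where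
  "is_derivation G D \<longleftrightarrow>
     (\<forall>X\<in>lie_algebra G. D X \<in> lie_algebra G) \<and>
     (\<forall>X\<in>lie_algebra G. \<forall>Y\<in>lie_algebra G. \<forall>a b.
        D (\<lambda>p. a *\<^sub>R X p + b *\<^sub>R Y p) = (\<lambda>p. a *\<^sub>R D X p + b *\<^sub>R D Y p)) \<and>
     (\<forall>X\<in>lie_algebra G. \<forall>Y\<in>lie_algebra G.
        D (lie_bracket G X Y) = (\<lambda>p. lie_bracket G (D X) Y p + lie_bracket G X (D Y) p))"

text \<open>For a left invariant metric g, the operator on the Lie algebra dual to the form RG.\<close>

definition RG_hat ::
  "(complex^'n^'n) set \<Rightarrow> (complex^'n^'n \<Rightarrow> complex^'n^'n \<Rightarrow> complex^'n^'n \<Rightarrow> real) \<Rightarrow>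
   ((complex^'n^'n \<Rightarrow> complex^'n^'n) \<Rightarrow> (complex^'n^'n \<Rightarrow> complex^'n^'n) \<Rightarrow>
     complex^'n^'n \<Rightarrow> complex^'n^'n) \<Rightarrow>
   ('i::finite \<Rightarrow> complex^'n^'n \<Rightarrow> complex^'n^'n) \<Rightarrow> real \<Rightarrow>
   (complex^'n^'n \<Rightarrow> complex^'n^'n) \<Rightarrow> (complex^'n^'n \<Rightarrow> complex^'n^'n)" where
  "RG_hat G g nabla e \<alpha> X =
     (THE Z. Z \<in> lie_algebra G \<and>
        (\<forall>Y\<in>lie_algebra G. \<forall>p\<in>G. g p (Z p) (Y p) = RG G g nabla e \<alpha> X Y p))"

definition algebraic_RG2_soliton ::
  "(complex^'n^'n) set \<Rightarrow> (complex^'n^'n \<Rightarrow> complex^'n^'n \<Rightarrow> complex^'n^'n \<Rightarrow> real) \<Rightarrow>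
   ((complex^'n^'n \<Rightarrow> complex^'n^'n) \<Rightarrow> (complex^'n^'n \<Rightarrow> complex^'n^'n) \<Rightarrow>
     complex^'n^'n \<Rightarrow> complex^'n^'n) \<Rightarrow>
   ('i::finite \<Rightarrow> complex^'n^'n \<Rightarrow> complex^'n^'n) \<Rightarrow> real \<Rightarrow> real \<Rightarrow> bool" where
  "algebraic_RG2_soliton G g nabla e \<alpha> \<kappa> \<longleftrightarrow>
     is_derivation G (\<lambda>X p. RG_hat G g nabla e \<alpha> X p - \<kappa> *\<^sub>R X p)"

definition steady_algebraic_RG2_soliton ::
  "(complex^'n^'n) set \<Rightarrow> (complex^'n^'n \<Rightarrow> complex^'n^'n \<Rightarrow> complex^'n^'n \<Rightarrow> real) \<Rightarrow>
   ((complex^'n^'n \<Rightarrow> complex^'n^'n) \<Rightarrow> (complex^'n^'n \<Rightarrow> complex^'n^'n) \<Rightarrow>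
     complex^'n^'n \<Rightarrow> complex^'n^'n) \<Rightarrow>
   ('i::finite \<Rightarrow> complex^'n^'n \<Rightarrow> complex^'n^'n) \<Rightarrow> real \<Rightarrow> bool" where
  "steady_algebraic_RG2_soliton G g nabla e \<alpha> \<longleftrightarrow> algebraic_RG2_soliton G g nabla e \<alpha> 0"

definition sectional_curvature ::
  "'a::euclidean_space set \<Rightarrow> ('a \<Rightarrow> 'a \<Rightarrow> 'a \<Rightarrow> real) \<Rightarrow>
   (('a \<Rightarrow> 'a) \<Rightarrow> ('a \<Rightarrow> 'a) \<Rightarrow> 'a \<Rightarrow> 'a) \<Rightarrow> ('a \<Rightarrow> 'a) \<Rightarrow> ('a \<Rightarrow> 'a) \<Rightarrow> 'a \<Rightarrow> real" where
  "sectional_curvature M g nabla X Y p =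
     Rm M g nabla X Y Y X p /
       (g p (X p) (X p) * g p (Y p) (Y p) - (g p (X p) (Y p))\<^sup>2)"

text \<open>
  Every tangent plane of G is spanned by the values of two left invariant fields, and the
  sectional curvature depends on the plane only.
\<close>

definition constant_sectional_curvature ::
  "(complex^'n^'n) set \<Rightarrow> (complex^'n^'n \<Rightarrow> complex^'n^'n \<Rightarrow> complex^'n^'n \<Rightarrow> real) \<Rightarrow>
   ((complex^'n^'n \<Rightarrow> complex^'n^'n) \<Rightarrow> (complex^'n^'n \<Rightarrow> complex^'n^'n) \<Rightarrow>
     complex^'n^'n \<Rightarrow> complex^'n^'n) \<Rightarrow> bool" where
  "constant_sectional_curvature G g nabla \<longleftrightarrow>
     (\<exists>K. \<forall>X\<in>lie_algebra G. \<forall>Y\<in>lie_algebra G. \<forall>p\<in>G.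
        X p \<noteq> Y p \<and> independent {X p, Y p} \<longrightarrow> sectional_curvature G g nabla X Y p = K)"

definition SU2 :: "(complex^2^2) set" where
  "SU2 = {p. p ** (\<chi> i j. cnj (p $ j $ i)) = mat 1 \<and> det p = 1}"

end

theory Submission imports Defs begin

text \<open>
  In a left invariant frame with these brackets and a diagonal metric, the Koszul formula shows that
  the curvature operator is diagonal on the planes \<open>e\<^sub>j \<and> e\<^sub>k\<close>, with sectional curvatures
  \<open>K\<^sub>1, K\<^sub>2, K\<^sub>3\<close>. Hence the RG operator is diagonal in the frame, with entries
  \<open>- f(K\<^sub>j) - f(K\<^sub>k)\<close> for \<open>f(K) = 2 K + \<alpha> K\<^sup>2\<close>. A diagonal derivation of
  \<open>su(2)\<close> vanishes, so the metric is a steady soliton iff every \<open>K\<^sub>i\<close> is \<open>0\<close> or \<open>-2/\<alpha>\<close>.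
  No two of the \<open>K\<^sub>i\<close> vanish simultaneously, so either all three agree, which forces
  \<open>A = B = C\<close>, or exactly one vanishes, which gives the other three cases.
\<close>

subsection \<open>Vector fields on a submanifold\<close>

lemma Ck_on_cong:
  assumes "open U" "\<And>x. x \<in> U \<Longrightarrow> f x = g x" "Ck_on k U f"
  shows "Ck_on k U g"
  using assms(2,3)
proof (induction k arbitrary: f g)
  case 0
  then show ?case by (simp cong: continuous_on_cong)
next
  case (Suc k)
  have diff: "f differentiable at x" if "x \<in> U" for x
    using Suc.prems(2) that assms(1) by (simp add: differentiable_on_eq_differentiable_at)
  have "g differentiable_on U"
    using Suc.prems
    by (auto simp: differentiable_on_def intro: differentiable_transform_within[OF _ zero_less_one])
  moreover have "Ck_on k U (\<lambda>x. frechet_derivative g (at x) v)" for v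
  proof (rule Suc.IH)
    show "frechet_derivative f (at x) v = frechet_derivative g (at x) v" if "x \<in> U" for x
      using frechet_derivative_transform_within_open[OF diff[OF that] assms(1) that Suc.prems(1)]
      by simp
    show "Ck_on k U (\<lambda>x. frechet_derivative f (at x) v)"
      using Suc.prems(2) by simp
  qed
  ultimately show ?case by simp
qed

lemma Ck_on_subset:
  assumes "open U" "open V" "V \<subseteq> U" "Ck_on k U f"
  shows "Ck_on k V f"
  using assms(4)
proof (induction k arbitrary: f)
  case 0
  then show ?case using assms(3) continuous_on_subset by auto
next
  case (Suc k)
  then show ?case using assms(3) differentiable_on_subset by auto
qed

lemma Ck_on_linear_combination:
  assumes "open U" "Ck_on k U f" "Ck_on k U g"
  shows "Ck_on k U (\<lambda>x. a *\<^sub>R f x + b *\<^sub>R g x)"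
  using assms(2,3)
proof (induction k arbitrary: f g)
  case 0
  then show ?case by (auto intro!: continuous_intros)
next
  case (Suc k)
  have diff: "f differentiable at x" "g differentiable at x" if "x \<in> U" for x
    using Suc.prems that assms(1) by (simp_all add: differentiable_on_eq_differentiable_at)
  have deriv: "((\<lambda>x. a *\<^sub>R f x + b *\<^sub>R g x) has_derivative
      (\<lambda>v. a *\<^sub>R frechet_derivative f (at x) v + b *\<^sub>R frechet_derivative g (at x) v)) (at x)"
    if "x \<in> U" for x
    using diff[OF that]
    by (intro has_derivative_add has_derivative_scaleR_right) (simp_all add: frechet_derivative_works)
  have "(\<lambda>x. a *\<^sub>R f x + b *\<^sub>R g x) differentiable_on U"
    using deriv assms(1) by (auto simp: differentiable_on_eq_differentiable_at differentiable_def)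
  moreover have "Ck_on k U (\<lambda>x. frechet_derivative (\<lambda>x. a *\<^sub>R f x + b *\<^sub>R g x) (at x) v)" for v
  proof (rule Ck_on_cong[OF assms(1)])
    show "Ck_on k U
        (\<lambda>x. a *\<^sub>R frechet_derivative f (at x) v + b *\<^sub>R frechet_derivative g (at x) v)"
      using Suc by simp
    show "a *\<^sub>R frechet_derivative f (at x) v + b *\<^sub>R frechet_derivative g (at x) v =
        frechet_derivative (\<lambda>x. a *\<^sub>R f x + b *\<^sub>R g x) (at x) v" if "x \<in> U" for x
      using fun_cong[OF frechet_derivative_at[OF deriv[OF that]]] .
  qed
  ultimately show ?case by simp
qed

lemma smooth_on_linear_combination:
  assumes "smooth_on M f" "smooth_on M g"
  shows "smooth_on M (\<lambda>x. a *\<^sub>R f x + b *\<^sub>R g x)"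
proof -
  obtain U F where U: "open U" "M \<subseteq> U" "\<And>k. Ck_on k U F" "\<And>p. p \<in> M \<Longrightarrow> F p = f p"
    using assms(1) unfolding smooth_on_def by metis
  obtain V H where V: "open V" "M \<subseteq> V" "\<And>k. Ck_on k V H" "\<And>p. p \<in> M \<Longrightarrow> H p = g p"
    using assms(2) unfolding smooth_on_def by metis
  have "Ck_on k (U \<inter> V) (\<lambda>x. a *\<^sub>R F x + b *\<^sub>R H x)" for k
    using U V by (intro Ck_on_linear_combination) (auto intro: Ck_on_subset)
  then show ?thesis
    unfolding smooth_on_def using U V
    by (intro exI[of _ "U \<inter> V"] exI[of _ "\<lambda>x. a *\<^sub>R F x + b *\<^sub>R H x"]) auto
qed

lemma Ck_on_const: "Ck_on k U (\<lambda>x. c)"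
  by (induction k arbitrary: c) (auto intro: differentiable_on_const)

lemma smooth_on_const: "smooth_on M (\<lambda>x. c)"
  unfolding smooth_on_def using Ck_on_const by blast

text \<open>Curves stay in \<open>M\<close>, so \<open>f\<close> is constant along each of them;
  tangency of \<open>v\<close> supplies one curve, which makes the value picked by
  \<open>THE\<close> unique.\<close>

lemma deriv_along_const:
  assumes "v \<in> tangent_space M p" "\<And>q. q \<in> M \<Longrightarrow> f q = c"
  shows "deriv_along M f p v = 0"
proof -
  have *: "((\<lambda>t. f (\<gamma> t)) has_vector_derivative 0) (at 0)" if "curve_through M p v \<gamma>" for \<gamma>
  proof -
    have "(\<lambda>t. f (\<gamma> t)) = (\<lambda>t. c)"
      using that assms(2) by (auto simp: curve_through_def)
    then show ?thesis by simp
  qed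
  obtain \<gamma> where \<gamma>: "curve_through M p v \<gamma>"
    using assms(1) by (auto simp: tangent_space_def)
  show ?thesis
    unfolding deriv_along_def
  proof (rule the_equality)
    fix d
    assume "\<forall>c. curve_through M p v c \<longrightarrow> ((\<lambda>t. f (c t)) has_vector_derivative d) (at 0)"
    with \<gamma> * show "d = 0"
      by (blast intro: vector_derivative_unique_at)
  qed (use * in auto)
qed

lemma vector_fields_linear_combination:
  assumes "\<And>p. p \<in> M \<Longrightarrow> subspace (tangent_space M p)"
    and "X \<in> vector_fields M" "Y \<in> vector_fields M"
  shows "(\<lambda>p. a *\<^sub>R X p + b *\<^sub>R Y p) \<in> vector_fields M"
  using assms
  by (auto simp: vector_fields_def subspace_add subspace_scale intro: smooth_on_linear_combination)

text \<open>Collapses three of the six index sums in \<open>Rm2\<close> once the inverse metric is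
  diagonal.\<close>

lemma sum_delta3:
  fixes f :: "3 \<Rightarrow> 3 \<Rightarrow> 3 \<Rightarrow> real"
  shows "(\<Sum>p\<in>UNIV. \<Sum>q\<in>UNIV. \<Sum>r\<in>UNIV. f p q r * (if k = p then a else 0) *
    (if l = q then b else 0) * (if n = r then c else 0)) = f k l n * a * b * c"
  using exhaust_3[of k] exhaust_3[of l] exhaust_3[of n] by (auto simp: sum_3)

lemma matrix_mult_scaleR_right: "a ** (c *\<^sub>R b) = c *\<^sub>R (a ** b)"
  for a :: "'a::real_algebra_1^'n^'m" and b :: "'a^'k^'n"
  by (simp add: matrix_matrix_mult_def vec_eq_iff scaleR_sum_right)

subsection \<open>Curvature in a frame with the brackets of su(2)\<close>

locale su2_frame =
  fixes M :: "'a::euclidean_space set"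
    and e :: "3 \<Rightarrow> 'a \<Rightarrow> 'a"
    and \<omega> :: "3 \<Rightarrow> 'a \<Rightarrow> 'a \<Rightarrow> real"
    and m :: "real^3"
    and g :: "'a \<Rightarrow> 'a \<Rightarrow> 'a \<Rightarrow> real"
    and nabla :: "('a \<Rightarrow> 'a) \<Rightarrow> ('a \<Rightarrow> 'a) \<Rightarrow> 'a \<Rightarrow> 'a"
  assumes frame: "is_frame M e"
    and bracket23: "lie_bracket M (e 2) (e 3) = e 1"
    and bracket31: "lie_bracket M (e 3) (e 1) = e 2"
    and bracket12: "lie_bracket M (e 1) (e 2) = e 3"
    and coframe: "is_dual_coframe M e \<omega>"
    and m_pos: "m $ i > 0"
    and metric: "g = (\<lambda>p u v. \<Sum>i\<in>UNIV. m $ i * (\<omega> i p u * \<omega> i p v))"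
    and connection: "levi_civita_connection M g nabla"
begin

text \<open>Constant-coefficient fields reduce the tensor computations to algebra in
  \<open>real^3\<close>, with \<open>cross3\<close> as bracket.\<close>

definition fld :: "real^3 \<Rightarrow> 'a \<Rightarrow> 'a" where
  "fld x p = (\<Sum>i\<in>UNIV. x $ i *\<^sub>R e i p)"

definition ip :: "real^3 \<Rightarrow> real^3 \<Rightarrow> real" where
  "ip x y = (\<Sum>i\<in>UNIV. m $ i * (x $ i * y $ i))"

text \<open>\<open>mu i\<close> are Milnor's connection coefficients, scaled by the metric: the covariant derivative
  along \<open>e\<^sub>i\<close> is the cross product with \<open>mu i e\<^sub>i\<close> followed by raising an index.\<close>

definition mu :: "real^3" where
  "mu = vector [(m$2 + m$3 - m$1) / 2, (m$1 + m$3 - m$2) / 2, (m$1 + m$2 - m$3) / 2]"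

definition conn :: "real^3 \<Rightarrow> real^3 \<Rightarrow> real^3" where
  "conn x y = (\<chi> k. cross3 (\<chi> i. mu $ i * x $ i) y $ k / m $ k)"

text \<open>\<open>sec $ i\<close> is the sectional curvature of the plane spanned by the two frame
  vectors other than \<open>e i\<close>.\<close>

definition sec :: "real^3" where
  "sec = vector [(mu$1 * m$1 - mu$2 * mu$3) / (m$1 * m$2 * m$3),
                 (mu$2 * m$2 - mu$1 * mu$3) / (m$1 * m$2 * m$3),
                 (mu$3 * m$3 - mu$1 * mu$2) / (m$1 * m$2 * m$3)]"

text \<open>The bivector of \<open>x\<close> and \<open>y\<close> is encoded as
  \<open>cross3 x y\<close>, on which the curvature form is diagonal. The minus sign makes
  \<open>curv x y y x\<close> the numerator of the sectional curvature.\<close>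

definition curv :: "real^3 \<Rightarrow> real^3 \<Rightarrow> real^3 \<Rightarrow> real^3 \<Rightarrow> real" where
  "curv x y z w =
     - (sec$1 * m$2 * m$3 * cross3 x y $ 1 * cross3 z w $ 1
        + sec$2 * m$1 * m$3 * cross3 x y $ 2 * cross3 z w $ 2
        + sec$3 * m$1 * m$2 * cross3 x y $ 3 * cross3 z w $ 3)"

text \<open>The eigenvalues of \<open>RG_hat\<close>; the factor 2 in \<open>Rm2_fld\<close> cancels
  the denominator of \<open>\<alpha> / 2\<close>.\<close>

definition rg_eigenvalue :: "real \<Rightarrow> real^3" where
  "rg_eigenvalue \<alpha> = vector
     [- 2 * (sec$2 + sec$3) - \<alpha> * ((sec$2)\<^sup>2 + (sec$3)\<^sup>2),
      - 2 * (sec$1 + sec$3) - \<alpha> * ((sec$1)\<^sup>2 + (sec$3)\<^sup>2),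
      - 2 * (sec$1 + sec$2) - \<alpha> * ((sec$1)\<^sup>2 + (sec$2)\<^sup>2)]"

section \<open>Coordinates with respect to the frame\<close>

lemma m_nonzero [simp]: "m $ i \<noteq> 0"
  using m_pos[of i] by simp

lemma frame_field: "e i \<in> vector_fields M"
  using frame by (simp add: is_frame_def)

lemma frame_outside: "p \<notin> M \<Longrightarrow> e i p = 0"
  using frame_field[of i] by (simp add: vector_fields_def)

lemma fld_axis: "fld (axis i 1) = e i"
proof
  show "fld (axis i 1) p = e i p" for p
    by (simp add: fld_def axis_def if_distrib[of "\<lambda>c. c *\<^sub>R _"] cong: if_cong)
qed

lemma fld_linear: "fld (a *\<^sub>R x + b *\<^sub>R y) p = a *\<^sub>R fld x p + b *\<^sub>R fld y p"
  by (simp add: fld_def sum.distrib scaleR_sum_right scaleR_add_left)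

lemma fld_diff: "fld (x - y) p = fld x p - fld y p"
  using fld_linear[of 1 x "-1" y p] by simp

lemma fld_outside: "p \<notin> M \<Longrightarrow> fld x p = 0"
  by (simp add: fld_def frame_outside)

lemma tangent_space_eq:
  assumes "p \<in> M"
  shows "tangent_space M p = range (\<lambda>x. fld x p)"
proof -
  have T: "tangent_space M p = span (range (\<lambda>i. e i p))" and inj: "inj (\<lambda>i. e i p)"
    using frame assms by (auto simp: is_frame_def)
  have "span (range (\<lambda>i. e i p)) = range (\<lambda>x. fld x p)"
  proof (intro equalityI subsetI)
    fix v assume "v \<in> span (range (\<lambda>i. e i p))"
    then obtain u where "v = (\<Sum>w\<in>range (\<lambda>i. e i p). u w *\<^sub>R w)"
      by (auto simp: span_finite)
    then have "v = fld (\<chi> i. u (e i p)) p"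
      by (simp add: fld_def sum.reindex[OF inj])
    then show "v \<in> range (\<lambda>x. fld x p)" by blast
  next
    fix v assume "v \<in> range (\<lambda>x. fld x p)"
    then obtain x where "v = fld x p" by blast
    then show "v \<in> span (range (\<lambda>i. e i p))"
      by (auto simp: fld_def intro!: span_sum intro: span_scale span_base)
  qed
  with T show ?thesis by simp
qed

lemma fld_tangent: "p \<in> M \<Longrightarrow> fld x p \<in> tangent_space M p"
  by (simp add: tangent_space_eq)

lemma subspace_tangent_space: "p \<in> M \<Longrightarrow> subspace (tangent_space M p)"
  using frame by (auto simp: is_frame_def) (metis subspace_span)

lemma coframe_fld:
  assumes "p \<in> M"
  shows "\<omega> i p (fld x p) = x $ i"
proof -
  have lin: "\<omega> i p (a *\<^sub>R u + b *\<^sub>R v) = a * \<omega> i p u + b * \<omega> i p v"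
    if "u \<in> tangent_space M p" "v \<in> tangent_space M p" for a b u v
    using coframe assms that by (simp add: is_dual_coframe_def)
  have dual: "\<omega> i p (e j p) = (if i = j then 1 else 0)" for j
    using coframe assms by (simp add: is_dual_coframe_def)
  have et: "e j p \<in> tangent_space M p" for j
    using fld_tangent[OF assms, of "axis j 1"] by (simp add: fld_axis)
  \<comment> \<open>\<open>\<omega>\<close> is linear on tangent vectors, so the partial sum must be
    tangent before the third term is split off.\<close>
  have "x $ 1 *\<^sub>R e 1 p + x $ 2 *\<^sub>R e 2 p \<in> tangent_space M p"
    by (intro subspace_add subspace_scale subspace_tangent_space assms et)
  from lin[OF this et, of 1 "x $ 3" 3]
  have "\<omega> i p (fld x p) = x $ 1 * \<omega> i p (e 1 p) + x $ 2 * \<omega> i p (e 2 p) + x $ 3 * \<omega> i p (e 3 p)"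
    by (simp add: fld_def sum_3 lin et)
  then show ?thesis
    using exhaust_3[of i] by (auto simp: dual)
qed

lemma fld_inject: "p \<in> M \<Longrightarrow> fld x p = fld y p \<longleftrightarrow> x = y"
  by (metis coframe_fld vec_eq_iff)

lemma metric_fld: "p \<in> M \<Longrightarrow> g p (fld x p) (fld y p) = ip x y"
  by (simp add: metric coframe_fld ip_def)

lemma ip_commute: "ip x y = ip y x"
  by (simp add: ip_def mult.commute)

lemma ip_diff_left: "ip (x - y) z = ip x z - ip y z"
  by (simp add: ip_def sum_subtractf algebra_simps)

lemma ip_axis: "ip x (axis i 1) = m $ i * x $ i"
  by (simp add: ip_def axis_def if_distrib[of "\<lambda>c. _ * c"] cong: if_cong)

lemma ip_eqI: "(\<And>z. ip x z = ip y z) \<Longrightarrow> x = y"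
  by (metis ip_axis vec_eq_iff m_nonzero mult_left_cancel)

text \<open>The nesting and the leading factor 1 fit the two-term shape of the linear combination
  lemmas, applied twice.\<close>

lemma fld_expand: "fld x = (\<lambda>p. 1 *\<^sub>R (x $ 1 *\<^sub>R e 1 p + x $ 2 *\<^sub>R e 2 p) + x $ 3 *\<^sub>R e 3 p)"
  by (simp add: fun_eq_iff fld_def sum_3)

lemma fld_field: "fld x \<in> vector_fields M"
  unfolding fld_expand
  by (intro vector_fields_linear_combination subspace_tangent_space frame_field)

section \<open>The Levi-Civita connection on constant-coefficient fields\<close>

lemma nabla_field:
  "X \<in> vector_fields M \<Longrightarrow> Y \<in> vector_fields M \<Longrightarrow> nabla X Y \<in> vector_fields M"
  using connection by (simp add: levi_civita_connection_def)

text \<open>A constant is a smooth function with zero derivative, so the Leibniz rule yields real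
  linearity in both arguments.\<close>

lemma nabla_linear_combination:
  assumes "X \<in> vector_fields M" "Y \<in> vector_fields M" "Z \<in> vector_fields M" "p \<in> M"
  shows "nabla (\<lambda>q. a *\<^sub>R X q + b *\<^sub>R Z q) Y p = a *\<^sub>R nabla X Y p + b *\<^sub>R nabla Z Y p"
    and "nabla Y (\<lambda>q. a *\<^sub>R X q + b *\<^sub>R Z q) p = a *\<^sub>R nabla Y X p + b *\<^sub>R nabla Y Z p"
proof -
  have scale: "(\<lambda>q. c *\<^sub>R W q) \<in> vector_fields M" if "W \<in> vector_fields M" for c W
    using vector_fields_linear_combination[OF subspace_tangent_space that that, of c 0] by simp
  have deriv: "deriv_along M (\<lambda>q. c) p (Y p) = 0" for c :: real
    using assms by (intro deriv_along_const[where c = c]) (auto simp: vector_fields_def)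
  have add: "nabla (\<lambda>q. V q + W q) Y p = nabla V Y p + nabla W Y p"
    "nabla Y (\<lambda>q. V q + W q) p = nabla Y V p + nabla Y W p"
    if "V \<in> vector_fields M" "W \<in> vector_fields M" for V W
    using connection that assms(2,4) unfolding levi_civita_connection_def by blast+
  have leibniz: "nabla (\<lambda>q. f q *\<^sub>R W q) Y p = f p *\<^sub>R nabla W Y p"
    "nabla Y (\<lambda>q. f q *\<^sub>R W q) p = deriv_along M f p (Y p) *\<^sub>R W p + f p *\<^sub>R nabla Y W p"
    if "W \<in> vector_fields M" "smooth_on M f" for f :: "'a \<Rightarrow> real" and W
    using connection that assms(2,4) unfolding levi_civita_connection_def by blast+
  have const: "nabla (\<lambda>q. c *\<^sub>R W q) Y p = c *\<^sub>R nabla W Y p"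
    "nabla Y (\<lambda>q. c *\<^sub>R W q) p = c *\<^sub>R nabla Y W p" if "W \<in> vector_fields M" for c W
    using leibniz[OF that smooth_on_const[of M c]] deriv[of c] by simp_all
  show "nabla (\<lambda>q. a *\<^sub>R X q + b *\<^sub>R Z q) Y p = a *\<^sub>R nabla X Y p + b *\<^sub>R nabla Z Y p"
    and "nabla Y (\<lambda>q. a *\<^sub>R X q + b *\<^sub>R Z q) p = a *\<^sub>R nabla Y X p + b *\<^sub>R nabla Y Z p"
    using add[OF scale[OF assms(1), of a] scale[OF assms(3), of b]] const assms(1,3) by simp_all
qed

lemma nabla_fld_expand:
  assumes "Y \<in> vector_fields M" "p \<in> M"
  shows "nabla (fld x) Y p = (\<Sum>i\<in>UNIV. x $ i *\<^sub>R nabla (e i) Y p)"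
    and "nabla Y (fld x) p = (\<Sum>i\<in>UNIV. x $ i *\<^sub>R nabla Y (e i) p)"
proof -
  have "(\<lambda>p. x $ 1 *\<^sub>R e 1 p + x $ 2 *\<^sub>R e 2 p) \<in> vector_fields M"
    by (intro vector_fields_linear_combination subspace_tangent_space frame_field)
  then show "nabla (fld x) Y p = (\<Sum>i\<in>UNIV. x $ i *\<^sub>R nabla (e i) Y p)"
    and "nabla Y (fld x) p = (\<Sum>i\<in>UNIV. x $ i *\<^sub>R nabla Y (e i) p)"
    unfolding fld_expand using assms
    by (simp_all add: nabla_linear_combination frame_field sum_3 del: scaleR_one) simp_all
qed

lemma torsion_free:
  "X \<in> vector_fields M \<Longrightarrow> Y \<in> vector_fields M \<Longrightarrow> p \<in> M \<Longrightarrow>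
    lie_bracket M X Y p = nabla X Y p - nabla Y X p"
  using connection by (simp add: levi_civita_connection_def)

text \<open>Torsion freeness expresses the bracket by the connection, whose bilinearity is known, so
  the three given brackets determine all others.\<close>

lemma lie_bracket_fld: "lie_bracket M (fld x) (fld y) = fld (cross3 x y)"
proof
  fix p
  show "lie_bracket M (fld x) (fld y) p = fld (cross3 x y) p"
  proof (cases "p \<in> M")
    case True
    have B: "nabla (e i) (e j) p = nabla (e j) (e i) p + lie_bracket M (e i) (e j) p" for i j
      using torsion_free[OF frame_field frame_field True] by simp
    have "nabla (fld x) (fld y) p - nabla (fld y) (fld x) p = fld (cross3 x y) p"
      using True B[of 1 2] B[of 2 3] B[of 3 1]
      by (simp add: nabla_fld_expand fld_field frame_field sum_3 fld_def cross3_def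
          bracket12 bracket23 bracket31 algebra_simps)
    then show ?thesis
      using torsion_free[OF fld_field fld_field True] by simp
  qed (simp add: lie_bracket_def fld_outside)
qed

lemma ip_conn: "ip (conn x y) z = (\<Sum>k\<in>UNIV. cross3 (\<chi> i. mu $ i * x $ i) y $ k * z $ k)"
  by (simp add: ip_def conn_def)

text \<open>Koszul formula for constant-coefficient fields: their inner products are constant, so
  only bracket terms remain. The half-sums in \<open>mu\<close> solve it.\<close>

lemma koszul: "2 * ip (conn x y) z = ip (cross3 x y) z - ip (cross3 y z) x + ip (cross3 z x) y"
  by (simp add: ip_conn) (simp add: ip_def sum_3 mu_def cross3_def field_simps)

text \<open>Uniqueness of the Levi-Civita connection: metric compatibility and torsion freeness give
  the Koszul formula at each point, and \<open>conn\<close> satisfies the same formula.\<close>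

lemma nabla_fld: "nabla (fld x) (fld y) = fld (conn x y)"
proof
  fix p
  show "nabla (fld x) (fld y) p = fld (conn x y) p"
  proof (cases "p \<in> M")
    case True
    \<comment> \<open>At the fixed point \<open>p\<close>, \<open>n x y\<close> holds frame
      coordinates of the derivative, which exist because it is tangent.\<close>
    define n where "n x y = (SOME z. nabla (fld x) (fld y) p = fld z p)" for x y
    have n: "nabla (fld x) (fld y) p = fld (n x y) p" for x y
    proof -
      have "nabla (fld x) (fld y) p \<in> tangent_space M p"
        using nabla_field[OF fld_field fld_field, of x y] True by (simp add: vector_fields_def)
      then show ?thesis
        unfolding n_def tangent_space_eq[OF True] by (metis (mono_tags) imageE someI)
    qed
    have compat: "ip (n x y) z + ip (n x z) y = 0" for x y z
    proof -
      have "deriv_along M (\<lambda>q. g q (fld y q) (fld z q)) p (fld x p) = 0"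
        using True by (intro deriv_along_const[where c = "ip y z"] fld_tangent) (simp_all add: metric_fld)
      moreover have "deriv_along M (\<lambda>q. g q (fld y q) (fld z q)) p (fld x p) =
          g p (nabla (fld x) (fld y) p) (fld z p) + g p (fld y p) (nabla (fld x) (fld z) p)"
        using connection fld_field True unfolding levi_civita_connection_def by blast
      ultimately show ?thesis
        by (simp add: n metric_fld[OF True] ip_commute[of y])
    qed
    have torsion: "ip (n x y) z - ip (n y x) z = ip (cross3 x y) z" for x y z
    proof -
      have "fld (n x y - n y x) p = fld (cross3 x y) p"
        using torsion_free[OF fld_field fld_field True, of x y]
        by (simp add: lie_bracket_fld n fld_diff)
      then have "n x y - n y x = cross3 x y"
        using fld_inject[OF True] by blast
      then show ?thesis
        by (metis ip_diff_left)
    qed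
    have "n x y = conn x y"
    proof (rule ip_eqI)
      \<comment> \<open>The compatibility identities with signs +, +, - and the torsion identities
        with signs +, -, + add up to the Koszul formula for \<open>n\<close>.\<close>
      show "ip (n x y) z = ip (conn x y) z" for z
        using koszul[of x y z] compat[of x y z] compat[of y z x] compat[of z x y]
          torsion[of x y z] torsion[of y z x] torsion[of z x y] by linarith
    qed
    with n show ?thesis by simp
  next
    case False
    then show ?thesis
      using nabla_field[OF fld_field fld_field] by (simp add: fld_outside vector_fields_def)
  qed
qed

section \<open>Curvature tensors in frame coordinates\<close>

lemma Rm_fld:
  assumes "p \<in> M"
  shows "Rm M g nabla (fld x) (fld y) (fld z) (fld w) p = curv x y z w"
proof -
  have "Rm M g nabla (fld x) (fld y) (fld z) (fld w) p =
      ip (conn x (conn y z) - conn y (conn x z) - conn (cross3 x y) z) w"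
    by (simp add: Rm_def lie_bracket_fld nabla_fld fld_diff[symmetric] metric_fld assms)
  also have "\<dots> = curv x y z w"
  proof -
    \<comment> \<open>Each coefficient is brought to a single denominator, making the claim a
      polynomial identity in \<open>mu\<close> and the reciprocals of \<open>m\<close>.\<close>
    have s: "sec$1 * m$2 * m$3 = mu$1 - mu$2 * mu$3 / m$1"
      "sec$2 * m$1 * m$3 = mu$2 - mu$1 * mu$3 / m$2"
      "sec$3 * m$1 * m$2 = mu$3 - mu$1 * mu$2 / m$3"
      by (simp_all add: sec_def field_simps)
    show ?thesis
      unfolding curv_def s
      by (simp add: ip_diff_left ip_conn sum_3)
        (simp add: conn_def cross3_def divide_inverse algebra_simps)
  qed
  finally show ?thesis .
qed

lemma inv_metric_frame:
  assumes "p \<in> M"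
  shows "inv_metric g e k l p = (if k = l then 1 / m $ k else 0)"
proof -
  define D where "D = ((\<chi> i j. g p (e i p) (e j p)) :: real^3^3)"
  define D' where "D' = ((\<chi> i j. if i = j then 1 / m $ i else 0) :: real^3^3)"
  have D: "D = (\<chi> i j. if i = j then m $ i else 0)"
    unfolding D_def fld_axis[symmetric] metric_fld[OF assms] ip_axis
    by (simp add: vec_eq_iff axis_def)
  have inv: "D ** D' = mat 1" "D' ** D = mat 1"
    by (simp_all add: D D'_def matrix_matrix_mult_def mat_def vec_eq_iff sum_3 forall_3)
  \<comment> \<open>\<open>matrix_inv\<close> is a choice among two-sided inverses;
    \<open>D'\<close> shows that one exists, and uniqueness identifies it.\<close>
  then have "D ** matrix_inv D = mat 1"
    unfolding matrix_inv_def by (rule_tac someI2[of _ D']) auto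
  then have "matrix_inv D = D'"
    by (metis inv(2) matrix_mul_assoc matrix_mul_lid matrix_mul_rid)
  then show ?thesis
    by (simp add: inv_metric_def D_def[symmetric] D'_def)
qed

lemma Rc_fld:
  assumes "p \<in> M"
  shows "Rc M g nabla e (fld x) (fld y) p =
    m$1 * (sec$2 + sec$3) * x$1 * y$1 + m$2 * (sec$1 + sec$3) * x$2 * y$2
      + m$3 * (sec$1 + sec$2) * x$3 * y$3"
proof -
  have "Rc M g nabla e (fld x) (fld y) p =
      (\<Sum>k\<in>UNIV. curv (axis k 1) x y (axis k 1) / m $ k)"
    by (simp add: Rc_def inv_metric_frame assms fld_axis[symmetric] Rm_fld sum_3)
  also have "\<dots> = m$1 * (sec$2 + sec$3) * x$1 * y$1 + m$2 * (sec$1 + sec$3) * x$2 * y$2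
      + m$3 * (sec$1 + sec$2) * x$3 * y$3"
    by (simp add: sum_3 curv_def cross3_def axis_def field_simps)
  finally show ?thesis .
qed

text \<open>For each frame plane containing a given direction, the last two indices can be ordered
  in two ways, whence the factor 2.\<close>

lemma Rm2_fld:
  assumes "p \<in> M"
  shows "Rm2 M g nabla e (fld x) (fld y) p =
    2 * (m$1 * ((sec$2)\<^sup>2 + (sec$3)\<^sup>2) * x$1 * y$1 + m$2 * ((sec$1)\<^sup>2 + (sec$3)\<^sup>2) * x$2 * y$2
      + m$3 * ((sec$1)\<^sup>2 + (sec$2)\<^sup>2) * x$3 * y$3)"
proof -
  have "Rm2 M g nabla e (fld x) (fld y) p =
      (\<Sum>k\<in>UNIV. \<Sum>l\<in>UNIV. \<Sum>n\<in>UNIV.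
        curv x (axis k 1) (axis l 1) (axis n 1) * curv y (axis k 1) (axis l 1) (axis n 1)
          / (m $ k * m $ l * m $ n))"
    unfolding Rm2_def inv_metric_frame[OF assms] fld_axis[symmetric] Rm_fld[OF assms]
    by (simp only: sum_delta3) simp
  also have "\<dots> = 2 * (m$1 * ((sec$2)\<^sup>2 + (sec$3)\<^sup>2) * x$1 * y$1
      + m$2 * ((sec$1)\<^sup>2 + (sec$3)\<^sup>2) * x$2 * y$2 + m$3 * ((sec$1)\<^sup>2 + (sec$2)\<^sup>2) * x$3 * y$3)"
    by (simp add: sum_3 curv_def cross3_def axis_def) (simp add: algebra_simps power2_eq_square)
  finally show ?thesis .
qed

lemma RG_fld:
  assumes "p \<in> M"
  shows "RG M g nabla e \<alpha> (fld x) (fld y) p = ip (\<chi> i. rg_eigenvalue \<alpha> $ i * x $ i) y"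
  by (simp add: RG_def Rc_fld Rm2_fld assms ip_def sum_3 rg_eigenvalue_def algebra_simps)

text \<open>By Lagrange's identity the Gram determinant is \<open>c\<^sup>2\<close> times the
  squared length of \<open>cross3 x y\<close>; for equal \<open>m $ i\<close> the curvature form is
  a multiple of the same quantity.\<close>

lemma sectional_curvature_fld:
  assumes "p \<in> M" "fld x p \<noteq> fld y p" "independent {fld x p, fld y p}"
    and "m $ 1 = c" "m $ 2 = c" "m $ 3 = c"
  shows "sectional_curvature M g nabla (fld x) (fld y) p = 1 / (4 * c)"
proof -
  define w where "w = cross3 x y"
  have "w \<noteq> 0"
  proof
    assume "w = 0"
    then consider "x = 0" | "y = 0" | k where "y = k *\<^sub>R x"
      by (auto simp: w_def cross_eq_0 collinear_lemma)
    then show False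
    proof cases
      case 3
      then have "fld y p = k *\<^sub>R fld x p"
        using fld_linear[of k x 0 x p] by simp
      then have "fld y p \<in> span {fld x p}"
        by (auto simp: span_singleton)
      then show False
        using assms(2,3) independent_insert[of "fld y p" "{fld x p}"] by (simp add: insert_commute)
    qed (use assms fld_linear[of 0 0 0 0 p] dependent_zero in auto)
  qed
  then have pos_w: "(w$1)\<^sup>2 + (w$2)\<^sup>2 + (w$3)\<^sup>2 \<noteq> 0"
    by (simp add: vec_eq_iff forall_3 add_nonneg_eq_0_iff)
  have c: "c \<noteq> 0" using assms(4) m_nonzero by blast
  have gram: "ip x x * ip y y - (ip x y)\<^sup>2 = c\<^sup>2 * ((w$1)\<^sup>2 + (w$2)\<^sup>2 + (w$3)\<^sup>2)"
    by (simp add: ip_def sum_3 w_def cross3_def assms(4-6) power2_eq_square algebra_simps)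
  have curv: "curv x y y x = c / 4 * ((w$1)\<^sup>2 + (w$2)\<^sup>2 + (w$3)\<^sup>2)"
  proof -
    have mu: "mu $ 1 = c / 2" "mu $ 2 = c / 2" "mu $ 3 = c / 2"
      by (simp_all add: mu_def assms(4-6))
    have sec: "sec $ 1 = 1 / (4 * c)" "sec $ 2 = 1 / (4 * c)" "sec $ 3 = 1 / (4 * c)"
      using c by (simp_all add: sec_def assms(4-6) mu divide_simps)
    moreover have "cross3 y x = - w"
      unfolding w_def by (rule cross_skew)
    ultimately show ?thesis
      using c unfolding curv_def w_def[symmetric] assms(4-6) sec
      by (simp add: field_simps power2_eq_square)
  qed
  have "c / 4 * W / (c\<^sup>2 * W) = 1 / (4 * c)" if "W \<noteq> 0" for W
    using that c by (simp add: field_simps power2_eq_square)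
  from this[OF pos_w] show ?thesis
    by (simp only: sectional_curvature_def Rm_fld[OF assms(1)] metric_fld[OF assms(1)] gram curv)
qed

end

subsection \<open>Left invariant fields and derivations\<close>

locale su2_left_invariant_frame =
  su2_frame G e \<omega> m g nabla
  for G :: "(complex^'n^'n) set" and e \<omega> m g nabla +
  assumes left_invariant: "e i \<in> lie_algebra G"
    and one_in: "mat 1 \<in> G"
begin

text \<open>A left invariant field is determined by its value at the identity; left translation is
  linear, so the frame coordinates found there serve at every point.\<close>

lemma lie_algebra_eq: "lie_algebra G = range fld"
proof (intro equalityI subsetI)
  fix X assume X: "X \<in> lie_algebra G"
  then have "X (mat 1) \<in> tangent_space G (mat 1)"
    using one_in by (simp add: lie_algebra_def vector_fields_def)
  then obtain x where x: "X (mat 1) = fld x (mat 1)"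
    using tangent_space_eq[OF one_in] by auto
  have "X p = fld x p" for p
  proof (cases "p \<in> G")
    case True
    have left: "Y p = p ** Y (mat 1)" if "Y \<in> lie_algebra G" for Y
      using that True one_in by (auto simp: lie_algebra_def) (metis matrix_mul_rid)
    show ?thesis
      using left[OF X] left[OF left_invariant] x
      by (simp add: fld_def sum_3 matrix_add_ldistrib matrix_mult_scaleR_right)
  next
    case False
    then show ?thesis
      using X by (simp add: lie_algebra_def vector_fields_def fld_outside)
  qed
  then show "X \<in> range fld" by blast
next
  fix X assume "X \<in> range fld"
  moreover have "fld x (a ** p) = a ** fld x p" if "a \<in> G" "p \<in> G" for a p x
    using left_invariant that
    by (simp add: lie_algebra_def fld_def sum_3 matrix_add_ldistrib matrix_mult_scaleR_right)
  ultimately show "X \<in> lie_algebra G"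
    using fld_field by (auto simp: lie_algebra_def)
qed

lemma fld_eq_iff: "fld x = fld y \<longleftrightarrow> x = y"
  using fld_inject[OF one_in] by metis

lemma RG_hat_fld:
  "RG_hat G g nabla e \<alpha> (fld x) = fld (\<chi> i. rg_eigenvalue \<alpha> $ i * x $ i)"
  unfolding RG_hat_def
proof (rule the_equality)
  fix Z
  assume Z: "Z \<in> lie_algebra G \<and>
    (\<forall>Y\<in>lie_algebra G. \<forall>p\<in>G. g p (Z p) (Y p) = RG G g nabla e \<alpha> (fld x) Y p)"
  then obtain z where z: "Z = fld z"
    by (auto simp: lie_algebra_eq)
  have "ip z y = ip (\<chi> i. rg_eigenvalue \<alpha> $ i * x $ i) y" for y
    using Z one_in by (auto simp: z lie_algebra_eq metric_fld RG_fld)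
  then show "Z = fld (\<chi> i. rg_eigenvalue \<alpha> $ i * x $ i)"
    using ip_eqI z by blast
qed (auto simp: lie_algebra_eq metric_fld RG_fld)

lemma steady_iff:
  "steady_algebraic_RG2_soliton G g nabla e \<alpha> \<longleftrightarrow> rg_eigenvalue \<alpha> = 0"
proof
  let ?D = "RG_hat G g nabla e \<alpha>"
  let ?r = "rg_eigenvalue \<alpha>"
  assume "steady_algebraic_RG2_soliton G g nabla e \<alpha>"
  then have der: "is_derivation G ?D"
    by (simp add: steady_algebraic_RG2_soliton_def algebraic_RG2_soliton_def)
  have D: "(\<chi> i. ?r $ i * cross3 x y $ i) =
      cross3 (\<chi> i. ?r $ i * x $ i) y + cross3 x (\<chi> i. ?r $ i * y $ i)" for x y
  proof -
    have "?D (lie_bracket G (fld x) (fld y)) =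
        (\<lambda>p. lie_bracket G (?D (fld x)) (fld y) p + lie_bracket G (fld x) (?D (fld y)) p)"
      using der by (simp add: is_derivation_def lie_algebra_eq)
    then have "fld (\<chi> i. ?r $ i * cross3 x y $ i) =
        fld (1 *\<^sub>R cross3 (\<chi> i. ?r $ i * x $ i) y + 1 *\<^sub>R cross3 x (\<chi> i. ?r $ i * y $ i))"
      unfolding fld_linear[abs_def] by (simp add: lie_bracket_fld RG_hat_fld)
    then show ?thesis
      by (simp add: fld_eq_iff)
  qed
  \<comment> \<open>With r1, r2, r3 the entries of \<open>?r\<close>, these brackets give r3 = r1 +
    r2, r1 = r2 + r3 and r2 = r3 + r1, so all vanish.\<close>
  from D[of "axis 1 1" "axis 2 1"] D[of "axis 2 1" "axis 3 1"] D[of "axis 3 1" "axis 1 1"]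
  show "?r = 0"
    by (simp add: vec_eq_iff forall_3 cross3_def axis_def)
next
  assume "rg_eigenvalue \<alpha> = 0"
  then have D: "RG_hat G g nabla e \<alpha> (fld x) = fld 0" for x
    by (simp add: RG_hat_fld zero_vec_def)
  have fld0: "fld 0 = (\<lambda>p. 0)"
    by (simp add: fld_def fun_eq_iff)
  have comb: "(\<lambda>p. a *\<^sub>R fld x p + b *\<^sub>R fld y p) = fld (a *\<^sub>R x + b *\<^sub>R y)" for a b x y
    by (simp add: fld_linear fun_eq_iff)
  have "is_derivation G (RG_hat G g nabla e \<alpha>)"
    by (auto simp: is_derivation_def lie_algebra_eq comb D lie_bracket_fld) (simp_all add: fld0)
  then show "steady_algebraic_RG2_soliton G g nabla e \<alpha>"
    by (simp add: steady_algebraic_RG2_soliton_def algebraic_RG2_soliton_def)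
qed

lemma constant_sectional_curvature_round:
  assumes "m $ 1 = c" "m $ 2 = c" "m $ 3 = c"
  shows "constant_sectional_curvature G g nabla"
  unfolding constant_sectional_curvature_def lie_algebra_eq
  using sectional_curvature_fld assms by blast

end

subsection \<open>The soliton equations\<close>

text \<open>This is \<open>4 x y z\<close> times the sectional curvature of the plane orthogonal to the frame vector
  of squared length \<open>x\<close>.\<close>

definition milnor :: "real \<Rightarrow> real \<Rightarrow> real \<Rightarrow> real" where
  "milnor x y z = (y - z)\<^sup>2 - 3 * x\<^sup>2 + 2 * x * (y + z)"

lemma milnor_commute: "milnor x y z = milnor x z y"
  by (simp add: milnor_def power2_commute algebra_simps)

text \<open>The difference of the two values factors as \<open>4 * (y - x) * (x + y - z)\<close>, up
  to sign of none of its factors.\<close>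

lemma milnor_eq:
  assumes "milnor x y z = milnor y x z"
  shows "x = y \<or> z = x + y"
proof -
  have "milnor x y z - milnor y x z = 4 * ((y - x) * (x + y - z))"
    by (simp add: milnor_def power2_eq_square algebra_simps)
  with assms show ?thesis by auto
qed

text \<open>The values on the second branch of \<open>milnor_eq\<close>; for positive arguments they
  are nonzero and of opposite sign, which later rules that branch out.\<close>

lemma milnor_sum: "milnor (y + z) y z = - 4 * y * z" "milnor x y (x + y) = 4 * x * y"
  by (simp_all add: milnor_def power2_eq_square algebra_simps)

lemma milnor_diag: "milnor x x z = z\<^sup>2"
  by (simp add: milnor_def power2_eq_square algebra_simps)

text \<open>By \<open>milnor_eq\<close> the common value would be \<open>z\<^sup>2\<close> or
  \<open>4 * x * y\<close>, neither of which is zero.\<close>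

lemma milnor_not_both_zero:
  assumes "x > 0" "y > 0" "z > 0" "milnor x y z = 0" "milnor y x z = 0"
  shows False
  using milnor_eq[of x y z] assms milnor_diag[of x z] milnor_sum(2)[of x y] by auto

text \<open>If \<open>x = y + z\<close>, the first value would be \<open>- 4 * y * z\<close>; hence
  \<open>y = z\<close>, and \<open>milnor x y y = x * (4 * y - 3 * x)\<close> produces the ratio
  4/3.\<close>

lemma milnor_one_zero:
  assumes "x > 0" "y > 0" "z > 0" "milnor x y z = 0" "milnor y x z = milnor z x y"
  shows "y = z \<and> x = 4 / 3 * y"
proof -
  have "x \<noteq> y + z"
    using assms milnor_sum(1)[of y z] by auto
  moreover have "milnor y z x = milnor z y x"
    using assms(5) by (metis milnor_commute)
  ultimately have "y = z"
    using milnor_eq by blast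
  with assms have "x * (4 * y - 3 * x) = 0"
    by (simp add: milnor_def power2_eq_square algebra_simps)
  with assms \<open>y = z\<close> show ?thesis by simp
qed

text \<open>If \<open>z = x + y\<close>, the first and third values would be
  \<open>4 * x * y\<close> and its negative; hence \<open>x = y\<close>, and then
  \<open>x = y + z\<close> contradicts \<open>z > 0\<close>.\<close>

lemma milnor_all_equal:
  assumes "x > 0" "y > 0" "z > 0" "milnor x y z = milnor y x z" "milnor y x z = milnor z x y"
  shows "x = y \<and> y = z"
proof -
  have "x = y \<or> z = x + y" "y = z \<or> x = y + z"
    using milnor_eq[of x y z] milnor_eq[of y z x] assms by (auto simp: milnor_commute)
  moreover have "z \<noteq> x + y"
  proof
    assume "z = x + y"
    then have "4 * x * y = - 4 * x * y"
      using assms milnor_sum(2)[of x y] milnor_sum(1)[of x y] by simp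
    with assms show False by simp
  qed
  ultimately show ?thesis using assms by auto
qed

text \<open>The conditions on \<open>sec\<close> with denominators cleared: a sectional curvature is
  a \<open>milnor\<close> value over \<open>2 * d\<close>, so \<open>- 2\<close> becomes
  \<open>- 4 * d\<close>.\<close>

lemma soliton_equations_iff:
  fixes \<alpha> x y z :: real
  assumes "x > 0" "y > 0" "z > 0"
  defines "d \<equiv> 2 * x * y * z"
  shows "(milnor x y z = 0 \<or> \<alpha> * milnor x y z = - 4 * d) \<and>
         (milnor y x z = 0 \<or> \<alpha> * milnor y x z = - 4 * d) \<and>
         (milnor z x y = 0 \<or> \<alpha> * milnor z x y = - 4 * d) \<longleftrightarrow>
         (x = y \<and> y = z \<and> \<alpha> = - 8 * x) \<or>
         (x = 4 / 3 * y \<and> x = 4 / 3 * z \<and> \<alpha> = - (9 / 2) * x) \<or>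
         (x = y \<and> x = 3 / 4 * z \<and> \<alpha> = - 6 * x) \<or>
         (x = z \<and> x = 3 / 4 * y \<and> \<alpha> = - 6 * x)"
    (is "?L \<longleftrightarrow> ?R")
proof
  assume ?L
  then have L: "milnor x y z = 0 \<or> \<alpha> * milnor x y z = - 4 * d"
    "milnor y x z = 0 \<or> \<alpha> * milnor y x z = - 4 * d"
    "milnor z x y = 0 \<or> \<alpha> * milnor z x y = - 4 * d"
    by auto
  have "d \<noteq> 0"
    using assms by simp
  \<comment> \<open>As \<open>d\<close> is nonzero, so is \<open>\<alpha>\<close>, and all nonzero
    \<open>milnor\<close> values equal \<open>- 4 * d / \<alpha>\<close>.\<close>
  then have eq: "u = v" if "\<alpha> * u = - 4 * d" "\<alpha> * v = - 4 * d" for u v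
    using that by (metis mult_cancel_left mult_eq_0_iff neg_equal_0_iff_equal zero_neq_numeral)
  consider (x) "milnor x y z = 0" "milnor y x z \<noteq> 0" "milnor z x y \<noteq> 0"
    | (y) "milnor y x z = 0" "milnor x y z \<noteq> 0" "milnor z x y \<noteq> 0"
    | (z) "milnor z x y = 0" "milnor x y z \<noteq> 0" "milnor y x z \<noteq> 0"
    | (none) "milnor x y z \<noteq> 0" "milnor y x z \<noteq> 0" "milnor z x y \<noteq> 0"
    using milnor_not_both_zero[of x y z] milnor_not_both_zero[of x z y]
      milnor_not_both_zero[of y z x] assms(1-3) by (auto simp: milnor_commute)
  then show ?R
  proof cases
    case x
    then have *: "z = y" "x = 4 / 3 * y"
      using milnor_one_zero[of x y z] eq L assms by blast+
    have "\<alpha> * milnor y x z = - 4 * d"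
      using x L by blast
    \<comment> \<open>Here \<open>milnor y x z = 16 / 9 * y\<^sup>2\<close> and
      \<open>d = 8 / 3 * y ^ 3\<close>, so \<open>\<alpha> = - 6 * y\<close>, which is
      \<open>- (9 / 2) * x\<close>.\<close>
    then have "y * y * (\<alpha> + 6 * y) = 0"
      by (simp add: * d_def milnor_def power2_eq_square field_simps)
    with * assms(2) show ?thesis
      by auto
  next
    case y
    then have *: "z = x" "y = 4 / 3 * x"
      using milnor_one_zero[of y x z] eq L assms by (metis milnor_commute)+
    have "\<alpha> * milnor x y z = - 4 * d"
      using y L by blast
    then have "x * x * (\<alpha> + 6 * x) = 0"
      by (simp add: * d_def milnor_def power2_eq_square field_simps)
    with * assms(1) show ?thesis
      by auto
  next
    case z
    then have *: "y = x" "z = 4 / 3 * x"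
      using milnor_one_zero[of z x y] eq L assms by (metis milnor_commute)+
    have "\<alpha> * milnor x y z = - 4 * d"
      using z L by blast
    then have "x * x * (\<alpha> + 6 * x) = 0"
      by (simp add: * d_def milnor_def power2_eq_square field_simps)
    with * assms(1) show ?thesis
      by auto
  next
    case none
    then have *: "y = x" "z = x"
      using milnor_all_equal[of x y z] eq L assms by blast+
    have "\<alpha> * milnor x y z = - 4 * d"
      using none L by blast
    then have "x * x * (\<alpha> + 8 * x) = 0"
      by (simp add: * d_def milnor_def power2_eq_square field_simps)
    with * assms(1) show ?thesis
      by auto
  qed
next
  assume ?R
  then show ?L
  proof (elim disjE)
    assume "x = 4 / 3 * y \<and> x = 4 / 3 * z \<and> \<alpha> = - (9 / 2) * x"
    then have "z = y" "x = 4 / 3 * y" "\<alpha> = - 6 * y" by auto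
    then show ?L
      by (simp add: d_def milnor_def power2_eq_square field_simps)
  next
    assume "x = y \<and> x = 3 / 4 * z \<and> \<alpha> = - 6 * x"
    then have "y = x" "z = 4 / 3 * x" "\<alpha> = - 6 * x" by auto
    then show ?L
      by (simp add: d_def milnor_def power2_eq_square field_simps)
  next
    assume "x = z \<and> x = 3 / 4 * y \<and> \<alpha> = - 6 * x"
    then have "z = x" "y = 4 / 3 * x" "\<alpha> = - 6 * x" by auto
    then show ?L
      by (simp add: d_def milnor_def power2_eq_square field_simps)
  qed (simp add: d_def milnor_def power2_eq_square field_simps)
qed

section \<open>The soliton condition in terms of sectional curvatures\<close>

context su2_frame
begin

lemma sec_milnor:
  "sec $ 1 = milnor (m$1) (m$2) (m$3) / (4 * m$1 * m$2 * m$3)"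
  "sec $ 2 = milnor (m$2) (m$1) (m$3) / (4 * m$1 * m$2 * m$3)"
  "sec $ 3 = milnor (m$3) (m$1) (m$2) / (4 * m$1 * m$2 * m$3)"
  by (simp_all add: sec_def mu_def milnor_def power2_eq_square field_simps)

text \<open>The eigenvalues are the negated pairwise sums of three numbers \<open>f i\<close>; these
  sums all vanish only if each \<open>f i\<close> does, and \<open>f i\<close> has the factor
  \<open>sec $ i\<close>.\<close>

lemma rg_eigenvalue_eq_0_iff:
  "rg_eigenvalue \<alpha> = 0 \<longleftrightarrow> (\<forall>i. sec $ i = 0 \<or> \<alpha> * sec $ i = - 2)"
proof -
  define f where "f i = 2 * sec $ i + \<alpha> * (sec $ i)\<^sup>2" for i
  have "rg_eigenvalue \<alpha> = vector [- f 2 - f 3, - f 1 - f 3, - f 1 - f 2]"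
    by (simp add: rg_eigenvalue_def f_def algebra_simps)
  then have "rg_eigenvalue \<alpha> = 0 \<longleftrightarrow> (\<forall>i. f i = 0)"
    by (auto simp: vec_eq_iff forall_3)
  moreover have "f i = sec $ i * (\<alpha> * sec $ i + 2)" for i
    by (simp add: f_def power2_eq_square algebra_simps)
  ultimately show ?thesis
    by (simp add: eq_neg_iff_add_eq_0)
qed

end

theorem proposition3p13:
  fixes \<alpha> A B C :: real
    and e :: "3 \<Rightarrow> complex^2^2 \<Rightarrow> complex^2^2"
    and \<omega> :: "3 \<Rightarrow> complex^2^2 \<Rightarrow> complex^2^2 \<Rightarrow> real"
    and g :: "complex^2^2 \<Rightarrow> complex^2^2 \<Rightarrow> complex^2^2 \<Rightarrow> real"
    and nabla :: "(complex^2^2 \<Rightarrow> complex^2^2) \<Rightarrow> (complex^2^2 \<Rightarrow> complex^2^2) \<Rightarrow>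
                  complex^2^2 \<Rightarrow> complex^2^2"
  assumes frame: "is_frame SU2 e"
    and left_invariant: "\<And>i. e i \<in> lie_algebra SU2"
    and bracket23: "lie_bracket SU2 (e 2) (e 3) = e 1"
    and bracket31: "lie_bracket SU2 (e 3) (e 1) = e 2"
    and bracket12: "lie_bracket SU2 (e 1) (e 2) = e 3"
    and coframe: "is_dual_coframe SU2 e \<omega>"
    and pos: "A > 0" "B > 0" "C > 0"
    and metric: "g = (\<lambda>p u v. A * (\<omega> 1 p u * \<omega> 1 p v) + B * (\<omega> 2 p u * \<omega> 2 p v)
                               + C * (\<omega> 3 p u * \<omega> 3 p v))"
    and connection: "levi_civita_connection SU2 g nabla"
  shows "steady_algebraic_RG2_soliton SU2 g nabla e \<alpha> \<longleftrightarrow>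
           (constant_sectional_curvature SU2 g nabla \<and> A = B \<and> B = C \<and> \<alpha> = - 8 * A) \<or>
           (A = 4 / 3 * B \<and> A = 4 / 3 * C \<and> \<alpha> = - (9 / 2) * A) \<or>
           (A = B \<and> A = 3 / 4 * C \<and> \<alpha> = - 6 * A) \<or>
           (A = C \<and> A = 3 / 4 * B \<and> \<alpha> = - 6 * A)"
proof -
  interpret su2_left_invariant_frame SU2 e \<omega> "vector [A, B, C]" g nabla
  proof
    show "(vector [A, B, C] :: real^3) $ i > 0" for i
      using exhaust_3[of i] pos by auto
    show "g = (\<lambda>p u v. \<Sum>i\<in>UNIV. (vector [A, B, C] :: real^3) $ i * (\<omega> i p u * \<omega> i p v))"
      by (simp add: metric sum_3)
    show "mat 1 \<in> SU2"
      by (simp add: SU2_def matrix_matrix_mult_def mat_def vec_eq_iff det_2 sum_2 forall_2)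
  qed (fact assms)+
  have "steady_algebraic_RG2_soliton SU2 g nabla e \<alpha> \<longleftrightarrow>
      (\<forall>i. sec $ i = 0 \<or> \<alpha> * sec $ i = - 2)"
    by (simp add: steady_iff rg_eigenvalue_eq_0_iff)
  also have "\<dots> \<longleftrightarrow> (A = B \<and> B = C \<and> \<alpha> = - 8 * A) \<or>
      (A = 4 / 3 * B \<and> A = 4 / 3 * C \<and> \<alpha> = - (9 / 2) * A) \<or>
      (A = B \<and> A = 3 / 4 * C \<and> \<alpha> = - 6 * A) \<or>
      (A = C \<and> A = 3 / 4 * B \<and> \<alpha> = - 6 * A)"
  proof -
    \<comment> \<open>Clears the common denominator in \<open>sec_milnor\<close>;
      \<open>2 * A * B * C\<close> is the \<open>d\<close> of
      \<open>soliton_equations_iff\<close>.\<close>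
    have K: "u / (4 * A * B * C) = 0 \<or> \<alpha> * (u / (4 * A * B * C)) = - 2 \<longleftrightarrow>
        u = 0 \<or> \<alpha> * u = - 4 * (2 * A * B * C)" for u
      using pos by (simp add: divide_simps algebra_simps)
    show ?thesis
      unfolding soliton_equations_iff[OF pos, symmetric] forall_3 sec_milnor vector_3 K ..
  qed
  \<comment> \<open>The curvature clause of the first case comes from the round metric with
    \<open>c = A\<close>.\<close>
  finally show ?thesis
    using constant_sectional_curvature_round[of A] by auto
qed

end
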